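(* Let $G=(A,R,C)$ be an abstract dialectical framework and let $F=(A,R,f_Q)$ be a ⊑-minimal abstraction of $G$, i.e. $F\in\Delta[G]$ and there is no $F'\in\Delta[G]$ with $F'\sqsubset F$. Let $\mathrm{Exact}_{\mathrm{one}}(F)$ be the set of exact labellings $\lambda$ of $F$ such that for every $a\in A$, $\lambda$ designates at most one label for $a$ in $F$. Then $\mathrm{Exact}_{\mathrm{one}}(F)\subseteq\mathrm{Exact}(G)$, where $\mathrm{Exact}(G)$ is the set of exact labellings of $G$.
   Context: Labels: $\mathcal{L}=\{\mathsf{in},\mathsf{out},\mathsf{undec}\}$. For a finite set $S$ of arguments, $\Lambda^S$ is the set of total functions $S\to\mathcal{L}$. A nuance tuple is $((n_1,n_2),(m_1,m_2))\in\mathbb{N}^4$ with $n_1\le n_2$, $m_1\le m_2$. A may-must argumentation (MMA) is $(A,R,f_Q)$ with $A$ finite, $R\subseteq A\times A$, $f_Q$ assigning a nuance tuple to each argument. $\mathrm{pre}(a)=\{b\in A:(b,a)\in R\}$. For $\lambda$ a labelling, $o_\lambda(a)$ (resp. $i_\lambda(a)$) is the number of $b\in\mathrm{pre}(a)$ with $\lambda(b)=\mathsf{out}$ (resp. $\mathsf{in}$). With $f_Q(a)=((n_1,n_2),(m_1,m_2))$: may-a iff $n_1\le o_\lambda(a)$; must-a iff $n_2\le o_\lambda(a)$; may$_s$-a iff $n_1\le o_\lambda(a)<n_2$; not-a iff $o_\lambda(a)<n_1$; may-r, must-r, may$_s$-r, not-r likewise with $m_1,m_2,i_\lambda(a)$.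 $\lambda$ designates $l$ for $a$ in the MMA iff $\lambda$ is defined on all of $\mathrm{pre}(a)$ and: $l=\mathsf{in}$ requires may-a and not must-r; $l=\mathsf{out}$ requires may-r and not must-a; $l=\mathsf{undec}$ requires (must-a and must-r) or may$_s$-a or may$_s$-r or (not-a and not-r). An abstract dialectical framework (ADF) is $(A,R,C)$ with $C=(C_a)_{a\in A}$, $C_a:\Lambda^{\mathrm{pre}(a)}\to\mathcal{L}$; $\lambda$ designates $l$ for $a$ in the ADF iff $\lambda$ is defined on $\mathrm{pre}(a)$ and $C_a(\lambda|_{\mathrm{pre}(a)})=l$. For an MMA or ADF with argument set $A$, $\lambda\in\Lambda^A$ is an exact labelling iff for every $a\in A$, $\lambda$ designates $\lambda(a)$ for $a$. $\Delta[G]$ (abstractions of ADF $G=(A,R,C)$): all MMAs $(A,R,f_Q)$ such that for every $a$, with $f_Q(a)=((n_1,n_2),(m_1,m_2))$, $n_2,m_2\le|\mathrm{pre}(a)|+1$, and for every $\lambda\in\Lambda^{\mathrm{pre}(a)}$, with $o=o_\lambda(a),i=i_\lambda(a)$: $o<n_1,i<m_1\Rightarrow C_a(\lambda)=\mathsf{undec}$; $n_1\le o<n_2,i<m_1\Rightarrow C_a(\lambda)\in\{\mathsf{in},\mathsf{undec}\}$; $n_2\le o,i<m_1\Rightarrow\mathsf{in}$; $o<n_1,m_1\le i<m_2\Rightarrow\{\mathsf{out},\mathsf{undec}\}$; $n_1\le o<n_2,m_1\le i<m_2\Rightarrow$ arbitrary; $n_2\le o,m_1\le i<m_2\Rightarrow\{\mathsf{in},\mathsf{undec}\}$;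 $o<n_1,m_2\le i\Rightarrow\mathsf{out}$; $n_1\le o<n_2,m_2\le i\Rightarrow\{\mathsf{out},\mathsf{undec}\}$; $n_2\le o,m_2\le i\Rightarrow\mathsf{undec}$. Order: $((n_1,n_2),(m_1,m_2))\unlhd((n_1',n_2'),(m_1',m_2'))$ iff $n_1'\le n_1$, $n_2\le n_2'$, $m_1'\le m_1$, $m_2\le m_2'$; $(A,R,f_Q)\sqsubseteq(A,R,f'_Q)$ iff $f_Q(a)\unlhd f'_Q(a)$ for all $a$; $F'\sqsubset F$ iff $F'\sqsubseteq F$ and not $F\sqsubseteq F'$. *)

theory Defs
  imports Main
begin

datatype label = In | Out | Undec

text \<open>
  A labelling with domain \<open>S\<close> is a partial map whose domain is exactly \<open>S\<close>.
\<close>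

definition labellings :: "'a set \<Rightarrow> ('a \<rightharpoonup> label) set" where
  "labellings S = {lam. dom lam = S}"

type_synonym nuance = "(nat \<times> nat) \<times> (nat \<times> nat)"

definition is_nuance :: "nuance \<Rightarrow> bool" where
  "is_nuance q \<longleftrightarrow> fst (fst q) \<le> snd (fst q) \<and> fst (snd q) \<le> snd (snd q)"

record 'a framework =
  args :: "'a set"
  att :: "('a \<times> 'a) set"

text \<open>
  The values of \<open>nuance\<close> and \<open>cond\<close> at non-arguments, and of \<open>cond G a\<close> at maps whose
  domain is not the set of predecessors of \<open>a\<close>, are irrelevant: no definition below
  makes an abstraction, a comparison or an exact labelling depend on them.
\<close>

record 'a mma = "'a framework" +
  nuance :: "'a \<Rightarrow> nuance"

record 'a adf = "'a framework" +
  cond :: "'a \<Rightarrow> ('a \<rightharpoonup> label) \<Rightarrow> label"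

definition is_framework :: "('a, 'x) framework_scheme \<Rightarrow> bool" where
  "is_framework F \<longleftrightarrow> finite (args F) \<and> att F \<subseteq> args F \<times> args F"

definition is_mma :: "'a mma \<Rightarrow> bool" where
  "is_mma F \<longleftrightarrow> is_framework F \<and> (\<forall>a \<in> args F. is_nuance (nuance F a))"

definition is_adf :: "'a adf \<Rightarrow> bool" where
  "is_adf G \<longleftrightarrow> is_framework G"

definition pre :: "('a, 'x) framework_scheme \<Rightarrow> 'a \<Rightarrow> 'a set" where
  "pre F a = {b \<in> args F. (b, a) \<in> att F}"

definition num_out :: "('a, 'x) framework_scheme \<Rightarrow> ('a \<rightharpoonup> label) \<Rightarrow> 'a \<Rightarrow> nat" where
  "num_out F lam a = card {b \<in> pre F a. lam b = Some Out}"

definition num_in :: "('a, 'x) framework_scheme \<Rightarrow> ('a \<rightharpoonup> label) \<Rightarrow> 'a \<Rightarrow> nat" where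
  "num_in F lam a = card {b \<in> pre F a. lam b = Some In}"

text \<open>Acceptance (suffix \<open>_a\<close>) and rejection (suffix \<open>_r\<close>) conditions.\<close>

definition may_a :: "'a mma \<Rightarrow> ('a \<rightharpoonup> label) \<Rightarrow> 'a \<Rightarrow> bool" where
  "may_a F lam a \<longleftrightarrow> fst (fst (nuance F a)) \<le> num_out F lam a"

definition must_a :: "'a mma \<Rightarrow> ('a \<rightharpoonup> label) \<Rightarrow> 'a \<Rightarrow> bool" where
  "must_a F lam a \<longleftrightarrow> snd (fst (nuance F a)) \<le> num_out F lam a"

definition mays_a :: "'a mma \<Rightarrow> ('a \<rightharpoonup> label) \<Rightarrow> 'a \<Rightarrow> bool" where
  "mays_a F lam a \<longleftrightarrow>
     fst (fst (nuance F a)) \<le> num_out F lam a \<and> num_out F lam a < snd (fst (nuance F a))"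

definition not_a :: "'a mma \<Rightarrow> ('a \<rightharpoonup> label) \<Rightarrow> 'a \<Rightarrow> bool" where
  "not_a F lam a \<longleftrightarrow> num_out F lam a < fst (fst (nuance F a))"

definition may_r :: "'a mma \<Rightarrow> ('a \<rightharpoonup> label) \<Rightarrow> 'a \<Rightarrow> bool" where
  "may_r F lam a \<longleftrightarrow> fst (snd (nuance F a)) \<le> num_in F lam a"

definition must_r :: "'a mma \<Rightarrow> ('a \<rightharpoonup> label) \<Rightarrow> 'a \<Rightarrow> bool" where
  "must_r F lam a \<longleftrightarrow> snd (snd (nuance F a)) \<le> num_in F lam a"

definition mays_r :: "'a mma \<Rightarrow> ('a \<rightharpoonup> label) \<Rightarrow> 'a \<Rightarrow> bool" where
  "mays_r F lam a \<longleftrightarrow>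
     fst (snd (nuance F a)) \<le> num_in F lam a \<and> num_in F lam a < snd (snd (nuance F a))"

definition not_r :: "'a mma \<Rightarrow> ('a \<rightharpoonup> label) \<Rightarrow> 'a \<Rightarrow> bool" where
  "not_r F lam a \<longleftrightarrow> num_in F lam a < fst (snd (nuance F a))"

definition designates_mma :: "'a mma \<Rightarrow> ('a \<rightharpoonup> label) \<Rightarrow> label \<Rightarrow> 'a \<Rightarrow> bool" where
  "designates_mma F lam l a \<longleftrightarrow> pre F a \<subseteq> dom lam \<and>
     (case l of
        In \<Rightarrow> may_a F lam a \<and> \<not> must_r F lam a
      | Out \<Rightarrow> may_r F lam a \<and> \<not> must_a F lam a
      | Undec \<Rightarrow> (must_a F lam a \<and> must_r F lam a) \<or> mays_a F lam a \<or> mays_r F lam a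
                 \<or> (not_a F lam a \<and> not_r F lam a))"

definition designates_adf :: "'a adf \<Rightarrow> ('a \<rightharpoonup> label) \<Rightarrow> label \<Rightarrow> 'a \<Rightarrow> bool" where
  "designates_adf G lam l a \<longleftrightarrow> pre G a \<subseteq> dom lam \<and> cond G a (lam |` pre G a) = l"

definition exact_mma :: "'a mma \<Rightarrow> ('a \<rightharpoonup> label) set" where
  "exact_mma F =
     {lam \<in> labellings (args F). \<forall>a \<in> args F. designates_mma F lam (the (lam a)) a}"

definition exact_adf :: "'a adf \<Rightarrow> ('a \<rightharpoonup> label) set" where
  "exact_adf G =
     {lam \<in> labellings (args G). \<forall>a \<in> args G. designates_adf G lam (the (lam a)) a}"

definition exact_one :: "'a mma \<Rightarrow> ('a \<rightharpoonup> label) set" where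
  "exact_one F =
     {lam \<in> exact_mma F. \<forall>a \<in> args F. \<exists>\<^sub>\<le>\<^sub>1 l. designates_mma F lam l a}"

definition abstracts_at :: "'a adf \<Rightarrow> 'a \<Rightarrow> nuance \<Rightarrow> bool" where
  "abstracts_at G a q = (case q of ((n1, n2), (m1, m2)) \<Rightarrow>
     n2 \<le> card (pre G a) + 1 \<and> m2 \<le> card (pre G a) + 1 \<and>
     (\<forall>lam \<in> labellings (pre G a).
        let out = num_out G lam a; inn = num_in G lam a; c = cond G a lam in
          (out < n1 \<and> inn < m1 \<longrightarrow> c = Undec) \<and>
          (n1 \<le> out \<and> out < n2 \<and> inn < m1 \<longrightarrow> c \<in> {In, Undec}) \<and>
          (n2 \<le> out \<and> inn < m1 \<longrightarrow> c = In) \<and>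
          (out < n1 \<and> m1 \<le> inn \<and> inn < m2 \<longrightarrow> c \<in> {Out, Undec}) \<and>
          (n1 \<le> out \<and> out < n2 \<and> m1 \<le> inn \<and> inn < m2 \<longrightarrow> c \<in> {In, Out, Undec}) \<and>
          (n2 \<le> out \<and> m1 \<le> inn \<and> inn < m2 \<longrightarrow> c \<in> {In, Undec}) \<and>
          (out < n1 \<and> m2 \<le> inn \<longrightarrow> c = Out) \<and>
          (n1 \<le> out \<and> out < n2 \<and> m2 \<le> inn \<longrightarrow> c \<in> {Out, Undec}) \<and>
          (n2 \<le> out \<and> m2 \<le> inn \<longrightarrow> c = Undec)))"

definition abstractions :: "'a adf \<Rightarrow> 'a mma set" where
  "abstractions G =
     {F. is_mma F \<and> args F = args G \<and> att F = att G \<and>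
         (\<forall>a \<in> args G. abstracts_at G a (nuance F a))}"

definition nuance_le :: "nuance \<Rightarrow> nuance \<Rightarrow> bool" where
  "nuance_le q q' = (case q of ((n1, n2), (m1, m2)) \<Rightarrow>
     case q' of ((n1', n2'), (m1', m2')) \<Rightarrow>
       n1' \<le> n1 \<and> n2 \<le> n2' \<and> m1' \<le> m1 \<and> m2 \<le> m2')"

definition mma_le :: "'a mma \<Rightarrow> 'a mma \<Rightarrow> bool" where
  "mma_le F F' \<longleftrightarrow> args F = args F' \<and> att F = att F' \<and>
     (\<forall>a \<in> args F. nuance_le (nuance F a) (nuance F' a))"

definition mma_less :: "'a mma \<Rightarrow> 'a mma \<Rightarrow> bool" where
  "mma_less F' F \<longleftrightarrow> mma_le F' F \<and> \<not> mma_le F F'"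

definition minimal_abstraction :: "'a adf \<Rightarrow> 'a mma \<Rightarrow> bool" where
  "minimal_abstraction G F \<longleftrightarrow>
     F \<in> abstractions G \<and> \<not> (\<exists>F' \<in> abstractions G. mma_less F' F)"

end

(* An abstraction designates at least the label that the ADF assigns, in each of the nine
   regions of the (out, in)-plane. Where it designates at most one label, the two agree. *)

theory Submission
  imports Defs
begin

text \<open>The thresholds in \<open>nuance F a\<close> cut the (out, in)-plane into regions, and in
  each region every label that \<open>abstracts_at\<close> permits for \<open>cond G a\<close> is
  one that \<open>F\<close> designates (\<open>abstraction_designates_cond\<close>). If
  \<open>lam\<close> is in \<open>exact_one F\<close>, then \<open>the (lam a)\<close> and the value
  of \<open>cond G a\<close> are both designated for \<open>a\<close>, so uniqueness makes them
  equal.\<close>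

lemma pre_cong:
  "args F = args G \<Longrightarrow> att F = att G \<Longrightarrow> pre F a = pre G a"
  by (simp add: pre_def)

lemma restrict_in_labellings:
  "S \<subseteq> dom lam \<Longrightarrow> lam |` S \<in> labellings S"
  by (auto simp: labellings_def)

text \<open>Only predecessors are counted. This carries \<open>abstracts_at\<close>, which speaks of
  labellings of \<open>pre G a\<close>, over to a labelling of all arguments.\<close>

lemma num_out_restrict:
  "pre F a = pre G a \<Longrightarrow> num_out G (lam |` pre G a) a = num_out F lam a"
  unfolding num_out_def by (rule arg_cong[where f = card]) auto

lemma num_in_restrict:
  "pre F a = pre G a \<Longrightarrow> num_in G (lam |` pre G a) a = num_in F lam a"
  unfolding num_in_def by (rule arg_cong[where f = card]) auto

lemma abstraction_designates_cond:
  assumes F: "F \<in> abstractions G" and a: "a \<in> args G" and dom: "pre G a \<subseteq> dom lam"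
  shows "designates_mma F lam (cond G a (lam |` pre G a)) a"
proof -
  obtain n1 n2 m1 m2 where q: "nuance F a = ((n1, n2), (m1, m2))"
    by (metis surj_pair)
  have nuance: "n1 \<le> n2" "m1 \<le> m2" and abs: "abstracts_at G a ((n1, n2), (m1, m2))"
    using F a q by (force simp: abstractions_def is_mma_def is_nuance_def)+
  have pre: "pre F a = pre G a"
    using F by (intro pre_cong) (auto simp: abstractions_def)
  define c where "c = cond G a (lam |` pre G a)"
  define p where "p = num_out F lam a"
  define i where "i = num_in F lam a"
  note regions = abs[unfolded abstracts_at_def prod.case, THEN conjunct2, THEN conjunct2,
      THEN bspec, OF restrict_in_labellings[OF dom], unfolded Let_def
      num_out_restrict[OF pre] num_in_restrict[OF pre], folded c_def p_def i_def]
  have "designates_mma F lam c a"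
    unfolding designates_mma_def may_a_def must_a_def mays_a_def not_a_def
      may_r_def must_r_def mays_r_def not_r_def q fst_conv snd_conv pre p_def[symmetric] i_def[symmetric]
    using regions nuance dom
    \<comment> \<open>Of the sixteen sign patterns, \<open>n1 \<le> n2\<close> and
      \<open>m1 \<le> m2\<close> leave the nine regions. They also make must imply may, as
      designating \<open>In\<close> or \<open>Out\<close> requires.\<close>
    by (cases "p < n1"; cases "p < n2"; cases "i < m1"; cases "i < m2"; cases c; simp)
  then show ?thesis
    by (simp add: c_def)
qed

theorem mainTheorem7:
  fixes G :: "'a adf" and F :: "'a mma"
  assumes "is_adf G"
    and "minimal_abstraction G F"
  shows "exact_one F \<subseteq> exact_adf G"
proof
  fix lam
  assume lam: "lam \<in> exact_one F"
  have F: "F \<in> abstractions G"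
    using assms(2) by (simp add: minimal_abstraction_def)
  then have args: "args F = args G"
    by (simp add: abstractions_def)
  have dom: "dom lam = args G"
    using lam args by (simp add: exact_one_def exact_mma_def labellings_def)
  have "designates_adf G lam (the (lam a)) a" if a: "a \<in> args G" for a
  proof -
    have pre: "pre G a \<subseteq> dom lam"
      by (auto simp: dom pre_def)
    have "designates_mma F lam (the (lam a)) a" "\<exists>\<^sub>\<le>\<^sub>1 l. designates_mma F lam l a"
      using lam a args by (auto simp: exact_one_def exact_mma_def)
    then have "cond G a (lam |` pre G a) = the (lam a)"
      using abstraction_designates_cond[OF F a pre] by (blast dest: Uniq_D)
    then show ?thesis
      using pre by (simp add: designates_adf_def)
  qed
  then show "lam \<in> exact_adf G"
    using dom by (simp add: exact_adf_def labellings_def)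
qed

end
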